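(* Let $(S,\cdot,I,\lambda,\rho)$ be a partial semigroup, let $i,j\in I$, and let $a\in S_{ji}$. If $x\in S_{ij}$, then: (i) $R_x^a = R_x\cap P_1^a$ if $x\in P_1^a$, and $R_x^a=\{x\}$ if $x\in S_{ij}\setminus P_1^a$; (ii) $L_x^a = L_x\cap P_2^a$ if $x\in P_2^a$, and $L_x^a=\{x\}$ if $x\in S_{ij}\setminus P_2^a$; (iii) $H_x^a = H_x$ if $x\in P^a$, and $H_x^a=\{x\}$ if $x\in S_{ij}\setminus P^a$; (iv) $D_x^a = D_x\cap P^a$ if $x\in P^a$; $D_x^a=L_x^a$ if $x\in P_2^a\setminus P_1^a$; $D_x^a=R_x^a$ if $x\in P_1^a\setminus P_2^a$; and $D_x^a=\{x\}$ if $x\in S_{ij}\setminus (P_1^a\cup P_2^a)$; (v) $J_x^a = J_x\cap P_3^a$ if $x\in P_3^a$, and $J_x^a=D_x^a$ if $x\in S_{ij}\setminus P_3^a$. Further, if $x\in S_{ij}\setminus P^a$, then $H_x^a=\{x\}$ is a non-group $\mathcal H^a$-class of the sandwich semigroup $S_{ij}^a$.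
   Context: A partial semigroup is a 5-tuple $(S,\cdot,I,\lambda,\rho)$ consisting of a set $S$, a partial binary operation $\cdot$ on $S$, a set $I$, and functions $\lambda,\rho:S\to I$ such that for all $x,y,z\in S$: (1) $x\cdot y$ is defined if and only if $\rho(x)=\lambda(y)$; (2) if $x\cdot y$ is defined, then $\lambda(x\cdot y)=\lambda(x)$ and $\rho(x\cdot y)=\rho(y)$; (3) if $x\cdot y$ and $y\cdot z$ are defined, then $(x\cdot y)\cdot z=x\cdot(y\cdot z)$. Write $xy$ for $x\cdot y$. For $i,j\in I$ put $S_{ij}=\{x\in S:\lambda(x)=i,\ \rho(x)=j\}$ and $S_i=S_{ii}$. Let $S^{(1)}$ be the partial semigroup obtained from $S$ by adjoining, for each $i\in I$ for which no such element exists already, an element $e_i$ (with $\lambda(e_i)=\rho(e_i)=i$) such that $xe_i=x$ and $e_iy=y$ for all $x,y$ with $\rho(x)=i$, $\lambda(y)=i$. Green's relations on $S$: for $x,y\in S$, $x\leq_{\mathcal R}y$ iff $x=ya$ for some $a\in S^{(1)}$; $x\leq_{\mathcal L}y$ iff $x=ay$ for some $a\in S^{(1)}$; $x\leq_{\mathcal J}y$ iff $x=ayb$ for some $a,b\in S^{(1)}$. For $\mathcal K\in\{\mathcal R,\mathcal L,\mathcal J\}$, $x\mathrel{\mathcal K}y$ iff $x\leq_{\mathcal K}y$ and $y\leq_{\mathcal K}x$. Also $\mathcal H=\mathcal R\cap\mathcal L$, and $\mathcal D=\mathcal R\vee\mathcal L$ is the join of equivalences (the transitive closure of $\mathcal R\cup\mathcal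 L$). For $x\in S_{ij}$ and $\mathcal K\in\{\mathcal R,\mathcal L,\mathcal J,\mathcal D,\mathcal H\}$, write $K_x=\{y\in S_{ij}: x\mathrel{\mathcal K}y\}$. For $a\in S_{ji}$, the sandwich semigroup $S_{ij}^a$ is the set $S_{ij}$ with the associative operation $x\star_a y=xay$. Write $\mathcal K^a$ for the usual Green's $\mathcal K$-relation of the semigroup $S_{ij}^a$ (defined with respect to that semigroup with an identity adjoined if necessary), and $K_x^a=\{y\in S_{ij}:x\mathrel{\mathcal K^a}y\}$. Define $P_1^a=\{x\in S_{ij}: xa\mathrel{\mathcal R}x\}$, $P_2^a=\{x\in S_{ij}: ax\mathrel{\mathcal L}x\}$, $P_3^a=\{x\in S_{ij}: axa\mathrel{\mathcal J}x\}$, and $P^a=P_1^a\cap P_2^a$, where $\mathcal R,\mathcal L,\mathcal J$ are the relations on $S$. *)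

theory Defs
  imports "HOL-Algebra.Group"
begin

text \<open>The partial operation is option-valued: \<open>pmult S x y = Some z\<close> means that \<open>x \<cdot> y\<close> is defined
  and equals \<open>z\<close>. Its values on arguments outside the carrier are unconstrained.\<close>

record ('a, 'i) psgp = "'a partial_object" +
  pmult :: "'a \<Rightarrow> 'a \<Rightarrow> 'a option"
  indices :: "'i set"
  lam :: "'a \<Rightarrow> 'i"
  rho :: "'a \<Rightarrow> 'i"

locale partial_semigroup =
  fixes S :: "('a, 'i) psgp"
  assumes lam_in: "x \<in> carrier S \<Longrightarrow> lam S x \<in> indices S"
    and rho_in: "x \<in> carrier S \<Longrightarrow> rho S x \<in> indices S"
    and pmult_closed: "\<lbrakk>x \<in> carrier S; y \<in> carrier S; pmult S x y = Some z\<rbrakk> \<Longrightarrow> z \<in> carrier S"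
    and defined_iff: "\<lbrakk>x \<in> carrier S; y \<in> carrier S\<rbrakk> \<Longrightarrow> pmult S x y \<noteq> None \<longleftrightarrow> rho S x = lam S y"
    and lam_pmult: "\<lbrakk>x \<in> carrier S; y \<in> carrier S; pmult S x y = Some z\<rbrakk> \<Longrightarrow> lam S z = lam S x"
    and rho_pmult: "\<lbrakk>x \<in> carrier S; y \<in> carrier S; pmult S x y = Some z\<rbrakk> \<Longrightarrow> rho S z = rho S y"
    and assoc: "\<lbrakk>x \<in> carrier S; y \<in> carrier S; z \<in> carrier S;
        pmult S x y = Some u; pmult S y z = Some v\<rbrakk> \<Longrightarrow> pmult S u z = pmult S x v"

definition pmult3 :: "('a, 'i) psgp \<Rightarrow> 'a \<Rightarrow> 'a \<Rightarrow> 'a \<Rightarrow> 'a option" where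
  "pmult3 S x y z = Option.bind (pmult S x y) (\<lambda>u. pmult S u z)"

definition hom_set :: "('a, 'i) psgp \<Rightarrow> 'i \<Rightarrow> 'i \<Rightarrow> 'a set" where
  "hom_set S i j = {x \<in> carrier S. lam S x = i \<and> rho S x = j}"

definition local_identity :: "('a, 'i) psgp \<Rightarrow> 'i \<Rightarrow> 'a \<Rightarrow> bool" where
  "local_identity S i e \<longleftrightarrow> e \<in> hom_set S i i \<and>
     (\<forall>x \<in> carrier S. rho S x = i \<longrightarrow> pmult S x e = Some x) \<and>
     (\<forall>y \<in> carrier S. lam S y = i \<longrightarrow> pmult S e y = Some y)"

text \<open>\<open>adjoin_ids S\<close> is $S^{(1)}$: \<open>Inl x\<close> is the original element \<open>x\<close>, and \<open>Inr i\<close> is the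
  new identity $e_i$, present only if \<open>S\<close> has no identity at \<open>i\<close>.\<close>

fun adjoin_pmult :: "('a, 'i) psgp \<Rightarrow> 'a + 'i \<Rightarrow> 'a + 'i \<Rightarrow> ('a + 'i) option" where
  "adjoin_pmult S (Inl x) (Inl y) = map_option Inl (pmult S x y)"
| "adjoin_pmult S (Inl x) (Inr i) = (if rho S x = i then Some (Inl x) else None)"
| "adjoin_pmult S (Inr i) (Inl y) = (if lam S y = i then Some (Inl y) else None)"
| "adjoin_pmult S (Inr i) (Inr j) = (if i = j then Some (Inr i) else None)"

definition adjoin_ids :: "('a, 'i) psgp \<Rightarrow> ('a + 'i, 'i) psgp" where
  "adjoin_ids S =
    \<lparr>carrier = Inl ` carrier S \<union> Inr ` {i \<in> indices S. \<nexists>e. local_identity S i e},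
     pmult = adjoin_pmult S,
     indices = indices S,
     lam = case_sum (lam S) id,
     rho = case_sum (rho S) id\<rparr>"

definition le_R :: "('a, 'i) psgp \<Rightarrow> 'a \<Rightarrow> 'a \<Rightarrow> bool" where
  "le_R S x y \<longleftrightarrow> x \<in> carrier S \<and> y \<in> carrier S \<and>
     (\<exists>a \<in> carrier (adjoin_ids S). pmult (adjoin_ids S) (Inl y) a = Some (Inl x))"

definition le_L :: "('a, 'i) psgp \<Rightarrow> 'a \<Rightarrow> 'a \<Rightarrow> bool" where
  "le_L S x y \<longleftrightarrow> x \<in> carrier S \<and> y \<in> carrier S \<and>
     (\<exists>a \<in> carrier (adjoin_ids S). pmult (adjoin_ids S) a (Inl y) = Some (Inl x))"

definition le_J :: "('a, 'i) psgp \<Rightarrow> 'a \<Rightarrow> 'a \<Rightarrow> bool" where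
  "le_J S x y \<longleftrightarrow> x \<in> carrier S \<and> y \<in> carrier S \<and>
     (\<exists>a \<in> carrier (adjoin_ids S). \<exists>b \<in> carrier (adjoin_ids S).
        pmult3 (adjoin_ids S) a (Inl y) b = Some (Inl x))"

definition green_R :: "('a, 'i) psgp \<Rightarrow> 'a rel" where
  "green_R S = {(x, y). le_R S x y \<and> le_R S y x}"

definition green_L :: "('a, 'i) psgp \<Rightarrow> 'a rel" where
  "green_L S = {(x, y). le_L S x y \<and> le_L S y x}"

definition green_J :: "('a, 'i) psgp \<Rightarrow> 'a rel" where
  "green_J S = {(x, y). le_J S x y \<and> le_J S y x}"

definition green_H :: "('a, 'i) psgp \<Rightarrow> 'a rel" where
  "green_H S = green_R S \<inter> green_L S"

definition green_D :: "('a, 'i) psgp \<Rightarrow> 'a rel" where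
  "green_D S = (green_R S \<union> green_L S)\<^sup>+"

text \<open>A semigroup is a partial semigroup with a one-element index set. For such \<open>T\<close>,
  \<open>adjoin_ids T\<close> is the usual $T^1$ (an identity is adjoined exactly if there is none), so the
  relations above are the usual Green's relations of the semigroup.\<close>

definition sandwich :: "('a, 'i) psgp \<Rightarrow> 'i \<Rightarrow> 'i \<Rightarrow> 'a \<Rightarrow> ('a, unit) psgp" where
  "sandwich S i j a =
    \<lparr>carrier = hom_set S i j,
     pmult = (\<lambda>x y. pmult3 S x a y),
     indices = {()},
     lam = (\<lambda>_. ()),
     rho = (\<lambda>_. ())\<rparr>"

text \<open>With \<open>K\<close> a relation of \<open>S\<close> this is $K_x$; with \<open>K\<close> a relation of \<open>sandwich S i j a\<close> it is
  $K_x^a$.\<close>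

definition green_class :: "('a, 'i) psgp \<Rightarrow> 'i \<Rightarrow> 'i \<Rightarrow> 'a rel \<Rightarrow> 'a \<Rightarrow> 'a set" where
  "green_class S i j K x = {y \<in> hom_set S i j. (x, y) \<in> K}"

definition P1 :: "('a, 'i) psgp \<Rightarrow> 'i \<Rightarrow> 'i \<Rightarrow> 'a \<Rightarrow> 'a set" where
  "P1 S i j a = {x \<in> hom_set S i j. \<exists>u. pmult S x a = Some u \<and> (u, x) \<in> green_R S}"

definition P2 :: "('a, 'i) psgp \<Rightarrow> 'i \<Rightarrow> 'i \<Rightarrow> 'a \<Rightarrow> 'a set" where
  "P2 S i j a = {x \<in> hom_set S i j. \<exists>u. pmult S a x = Some u \<and> (u, x) \<in> green_L S}"

definition P3 :: "('a, 'i) psgp \<Rightarrow> 'i \<Rightarrow> 'i \<Rightarrow> 'a \<Rightarrow> 'a set" where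
  "P3 S i j a = {x \<in> hom_set S i j. \<exists>u. pmult3 S a x a = Some u \<and> (u, x) \<in> green_J S}"

definition P12 :: "('a, 'i) psgp \<Rightarrow> 'i \<Rightarrow> 'i \<Rightarrow> 'a \<Rightarrow> 'a set" where
  "P12 S i j a = P1 S i j a \<inter> P2 S i j a"

text \<open>The subset \<open>A\<close> of the semigroup \<open>T\<close> is a group under the operation of \<open>T\<close>. The operation
  of a semigroup is defined everywhere, so \<open>the\<close> loses nothing here.\<close>

definition is_group_under :: "('a, unit) psgp \<Rightarrow> 'a set \<Rightarrow> bool" where
  "is_group_under T A \<longleftrightarrow>
     (\<exists>e. group \<lparr>carrier = A, monoid.mult = (\<lambda>x y. the (pmult T x y)), one = e\<rparr>)"

lemma (in partial_semigroup) partial_semigroup_adjoin_ids: "partial_semigroup (adjoin_ids S)"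
proof
  fix x y z u v
  assume h: "x \<in> carrier (adjoin_ids S)" "y \<in> carrier (adjoin_ids S)" "z \<in> carrier (adjoin_ids S)"
    "pmult (adjoin_ids S) x y = Some u" "pmult (adjoin_ids S) y z = Some v"
  show "pmult (adjoin_ids S) u z = pmult (adjoin_ids S) x v"
  proof (cases "\<exists>k. x = Inr k \<or> y = Inr k \<or> z = Inr k")
    case True
    show ?thesis
    proof (cases y)
      case (Inr k)
      then show ?thesis
        using h by (cases x; cases z) (simp_all add: adjoin_ids_def split: if_splits)
    next
      case y: (Inl y')
      show ?thesis
      proof (cases x)
        case (Inr k)
        then show ?thesis
          using h y lam_pmult[of y']
          by (cases z) (auto simp: adjoin_ids_def split: if_splits)
      next
        case (Inl x')
        then obtain k where "z = Inr k"
          using True y by auto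
        then show ?thesis
          using h y Inl rho_pmult[of x' y']
          by (auto simp: adjoin_ids_def split: if_splits)
      qed
    qed
  next
    case False
    then obtain x' y' z' where xyz: "x = Inl x'" "y = Inl y'" "z = Inl z'"
      by (metis sum.exhaust)
    then obtain u' v' where "u = Inl u'" "v = Inl v'" "pmult S x' y' = Some u'" "pmult S y' z' = Some v'"
      using h by (auto simp: adjoin_ids_def)
    then show ?thesis
      using xyz h assoc[of x' y' z' u' v'] by (auto simp: adjoin_ids_def)
  qed
next
  fix x y
  assume "x \<in> carrier (adjoin_ids S)" "y \<in> carrier (adjoin_ids S)"
  then show "pmult (adjoin_ids S) x y \<noteq> None \<longleftrightarrow> rho (adjoin_ids S) x = lam (adjoin_ids S) y"
    using defined_iff[of "projl x" "projl y"] by (cases x; cases y) (auto simp: adjoin_ids_def)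
next
  fix x y z
  assume h: "x \<in> carrier (adjoin_ids S)" "y \<in> carrier (adjoin_ids S)"
    "pmult (adjoin_ids S) x y = Some z"
  have "z \<in> carrier (adjoin_ids S) \<and> lam (adjoin_ids S) z = lam (adjoin_ids S) x \<and>
      rho (adjoin_ids S) z = rho (adjoin_ids S) y"
  proof (cases "\<exists>x' y'. x = Inl x' \<and> y = Inl y'")
    case True
    then obtain x' y' where xy: "x = Inl x'" "y = Inl y'"
      by blast
    then obtain z' where "z = Inl z'" "pmult S x' y' = Some z'"
      using h by (auto simp: adjoin_ids_def)
    then show ?thesis
      using xy h pmult_closed[of x' y' z'] lam_pmult[of x' y' z'] rho_pmult[of x' y' z']
      by (auto simp: adjoin_ids_def)
  next
    case False
    then show ?thesis
      using h by (cases x; cases y) (auto simp: adjoin_ids_def split: if_splits)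
  qed
  then show "z \<in> carrier (adjoin_ids S)" "lam (adjoin_ids S) z = lam (adjoin_ids S) x"
    "rho (adjoin_ids S) z = rho (adjoin_ids S) y"
    by blast+
qed (auto simp: adjoin_ids_def lam_in rho_in)

lemma (in partial_semigroup) pmult_hom_set:
  assumes "x \<in> hom_set S i j" "y \<in> hom_set S j k"
  obtains z where "pmult S x y = Some z" "z \<in> hom_set S i k"
  using assms defined_iff[of x y] lam_pmult[of x y] rho_pmult[of x y] pmult_closed[of x y]
  by (auto simp: hom_set_def)

lemma (in partial_semigroup) partial_semigroup_sandwich:
  assumes a: "a \<in> hom_set S j i"
  shows "partial_semigroup (sandwich S i j a)"
proof -
  have closed: "\<exists>z. pmult3 S x a y = Some z \<and> z \<in> hom_set S i j"
    if xy: "x \<in> hom_set S i j" "y \<in> hom_set S i j" for x y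
  proof -
    obtain w where w: "pmult S x a = Some w" "w \<in> hom_set S i i"
      using xy(1) a by (rule pmult_hom_set)
    obtain z where "pmult S w y = Some z" "z \<in> hom_set S i j"
      using w(2) xy(2) by (rule pmult_hom_set)
    then show ?thesis
      using w(1) by (simp add: pmult3_def)
  qed
  have assoc3: "pmult3 S u a z = pmult3 S x a v"
    if xyz: "x \<in> hom_set S i j" "y \<in> hom_set S i j" "z \<in> hom_set S i j"
      and u: "pmult3 S x a y = Some u" and v: "pmult3 S y a z = Some v" for x y z u v
  proof -
    obtain xa where xa: "pmult S x a = Some xa" "xa \<in> hom_set S i i"
      using xyz(1) a by (rule pmult_hom_set)
    obtain ya where ya: "pmult S y a = Some ya" "ya \<in> hom_set S i i"
      using xyz(2) a by (rule pmult_hom_set)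
    obtain ua where ua: "pmult S u a = Some ua"
    proof -
      have "u \<in> hom_set S i j"
        using closed[OF xyz(1,2)] u by simp
      then show thesis
        using a that by (rule pmult_hom_set)
    qed
    have xay: "pmult S xa y = Some u" and yaz: "pmult S ya z = Some v"
      using u v xa ya by (auto simp: pmult3_def)
    have "pmult S u a = pmult S xa ya"
      using assoc[of xa y a u ya] xay xa ya xyz a by (auto simp: hom_set_def)
    then have "pmult S ua z = pmult S xa v"
      using assoc[of xa ya z ua v] ua yaz xa ya xyz by (auto simp: hom_set_def)
    then show ?thesis
      using ua xa by (simp add: pmult3_def)
  qed
  show ?thesis
  proof
    fix x y z u v
    assume "x \<in> carrier (sandwich S i j a)" "y \<in> carrier (sandwich S i j a)"
      "z \<in> carrier (sandwich S i j a)"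
      "pmult (sandwich S i j a) x y = Some u" "pmult (sandwich S i j a) y z = Some v"
    then show "pmult (sandwich S i j a) u z = pmult (sandwich S i j a) x v"
      using assoc3[of x y z u v] by (simp add: sandwich_def)
  next
    fix x y z
    assume "x \<in> carrier (sandwich S i j a)" "y \<in> carrier (sandwich S i j a)"
    then obtain z' where z': "pmult (sandwich S i j a) x y = Some z'" "z' \<in> carrier (sandwich S i j a)"
      using closed[of x y] by (auto simp: sandwich_def)
    then show "pmult (sandwich S i j a) x y \<noteq> None \<longleftrightarrow>
        rho (sandwich S i j a) x = lam (sandwich S i j a) y"
      by (simp add: sandwich_def)
    show "z \<in> carrier (sandwich S i j a)" if "pmult (sandwich S i j a) x y = Some z"
      using that z' by simp
  qed (simp_all add: sandwich_def)
qed

end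

theory Submission
  imports Defs
begin

text \<open>Write \<open>T\<close> for the sandwich semigroup, and call \<open>x\<close> strictly below \<open>y\<close> if \<open>x\<close> is a multiple of
  \<open>y\<close> by honest elements, no identity being adjoined. Then \<open>P1\<close>, \<open>P2\<close> and \<open>P3\<close> consist of the
  elements lying in \<open>x \<star> T\<close>, \<open>T \<star> x\<close> and \<open>T \<star> x \<star> T\<close> respectively, and elements with nontrivial
  \<open>R\<close>- or \<open>L\<close>-class in \<open>T\<close> are strictly below themselves. Below such a regular element the factor
  \<open>a\<close> can be inserted for free, since \<open>x = x a w\<close> gives \<open>x u = x a (w u)\<close>, so there the relations
  of \<open>S\<close> and \<open>T\<close> agree. If \<open>x \<notin> P3\<close> and \<open>x\<close>, \<open>y\<close> are \<open>J\<close>-related in \<open>T\<close>, then the multipliers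
  on one of the two sides must all be identities, leaving \<open>R\<close>- or \<open>L\<close>-related elements.\<close>

section \<open>Green's relations via strict divisibility\<close>

text \<open>Totalised through \<open>the\<close>, so that products can be rewritten as terms; the
  value is meaningful only when \<open>rho S x = lam S y\<close>, and the calculation rules carry
  that condition.\<close>

definition pprod :: "('a, 'i) psgp \<Rightarrow> 'a \<Rightarrow> 'a \<Rightarrow> 'a" where
  "pprod S x y = the (pmult S x y)"

text \<open>With no identity adjoined this need not be reflexive; a diagonal pair
  \<open>(x, x)\<close> in it is the regularity that separates the cases of the theorem.\<close>

definition strict_R :: "('a, 'i) psgp \<Rightarrow> 'a rel" where
  "strict_R S = {(x, y). x \<in> carrier S \<and> y \<in> carrier S \<and>
     (\<exists>u \<in> carrier S. rho S y = lam S u \<and> x = pprod S y u)}"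

definition strict_L :: "('a, 'i) psgp \<Rightarrow> 'a rel" where
  "strict_L S = {(x, y). x \<in> carrier S \<and> y \<in> carrier S \<and>
     (\<exists>u \<in> carrier S. rho S u = lam S y \<and> x = pprod S u y)}"

text \<open>A two-sided multiple is a right multiple of a left multiple; in this form facts about
  \<open>J\<close> reduce to facts about \<open>R\<close> and \<open>L\<close>.\<close>

definition strict_J :: "('a, 'i) psgp \<Rightarrow> 'a rel" where
  "strict_J S = strict_R S O strict_L S"

context partial_semigroup
begin

section \<open>Calculating with the totalised product\<close>

abbreviation mul (infixl "\<cdot>" 70) where "x \<cdot> y \<equiv> pprod S x y"

lemma pmult_eq: "\<lbrakk>x \<in> carrier S; y \<in> carrier S; rho S x = lam S y\<rbrakk> \<Longrightarrow> pmult S x y = Some (x \<cdot> y)"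
  using defined_iff[of x y] by (auto simp: pprod_def)

lemma pmult_eq_Some_iff:
  "\<lbrakk>x \<in> carrier S; y \<in> carrier S\<rbrakk> \<Longrightarrow> pmult S x y = Some z \<longleftrightarrow> rho S x = lam S y \<and> z = x \<cdot> y"
  using defined_iff[of x y] pmult_eq[of x y] by auto

lemma mul_closed [simp]: "\<lbrakk>x \<in> carrier S; y \<in> carrier S; rho S x = lam S y\<rbrakk> \<Longrightarrow> x \<cdot> y \<in> carrier S"
  using pmult_closed pmult_eq by blast

lemma lam_mul [simp]: "\<lbrakk>x \<in> carrier S; y \<in> carrier S; rho S x = lam S y\<rbrakk> \<Longrightarrow> lam S (x \<cdot> y) = lam S x"
  using lam_pmult pmult_eq by blast

lemma rho_mul [simp]: "\<lbrakk>x \<in> carrier S; y \<in> carrier S; rho S x = lam S y\<rbrakk> \<Longrightarrow> rho S (x \<cdot> y) = rho S y"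
  using rho_pmult pmult_eq by blast

lemma mul_assoc [simp]:
  assumes "x \<in> carrier S" "y \<in> carrier S" "z \<in> carrier S"
    and "rho S x = lam S y" "rho S y = lam S z"
  shows "x \<cdot> y \<cdot> z = x \<cdot> (y \<cdot> z)"
  using assoc[OF assms(1-3) pmult_eq pmult_eq] assms by (simp add: pprod_def)

section \<open>Transitivity and commutation of strict divisibility\<close>

lemma strict_RD: "(x, y) \<in> strict_R S \<Longrightarrow> x \<in> carrier S \<and> y \<in> carrier S \<and> lam S x = lam S y"
  by (auto simp: strict_R_def)

lemma strict_LD: "(x, y) \<in> strict_L S \<Longrightarrow> x \<in> carrier S \<and> y \<in> carrier S \<and> rho S x = rho S y"
  by (auto simp: strict_L_def)

lemma strict_R_trans: "trans (strict_R S)"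
proof (rule transI)
  fix x y z assume "(x, y) \<in> strict_R S" "(y, z) \<in> strict_R S"
  then obtain u v where "x \<in> carrier S" "z \<in> carrier S" "u \<in> carrier S" "v \<in> carrier S"
    "rho S z = lam S u" "y = z \<cdot> u" "rho S y = lam S v" "x = y \<cdot> v"
    by (auto simp: strict_R_def)
  then show "(x, z) \<in> strict_R S"
    by (auto simp: strict_R_def intro!: bexI[of _ "u \<cdot> v"])
qed

lemma strict_L_trans: "trans (strict_L S)"
proof (rule transI)
  fix x y z assume "(x, y) \<in> strict_L S" "(y, z) \<in> strict_L S"
  then obtain u v where "x \<in> carrier S" "z \<in> carrier S" "u \<in> carrier S" "v \<in> carrier S"
    "rho S u = lam S z" "y = u \<cdot> z" "rho S v = lam S y" "x = v \<cdot> y"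
    by (auto simp: strict_L_def)
  then show "(x, z) \<in> strict_L S"
    by (auto simp: strict_L_def intro!: bexI[of _ "v \<cdot> u"])
qed

text \<open>Associativity alone: \<open>(u y) v = u (y v)\<close>, so \<open>u y\<close> and
  \<open>y v\<close> are the two possible intermediate elements.\<close>

lemma strict_R_L_commute: "strict_R S O strict_L S = strict_L S O strict_R S"
proof (intro subset_antisym subrelI)
  fix x y assume "(x, y) \<in> strict_R S O strict_L S"
  then obtain z u v where "x \<in> carrier S" "y \<in> carrier S" "u \<in> carrier S" "v \<in> carrier S"
    "rho S u = lam S y" "z = u \<cdot> y" "rho S z = lam S v" "x = z \<cdot> v"
    by (auto simp: strict_L_def strict_R_def)
  then show "(x, y) \<in> strict_L S O strict_R S"
    by (auto simp: strict_R_def strict_L_def intro!: relcompI[of _ "y \<cdot> v"])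
next
  fix x y assume "(x, y) \<in> strict_L S O strict_R S"
  then obtain z u v where "x \<in> carrier S" "y \<in> carrier S" "u \<in> carrier S" "v \<in> carrier S"
    "rho S y = lam S u" "z = y \<cdot> u" "rho S v = lam S z" "x = v \<cdot> z"
    by (auto simp: strict_L_def strict_R_def)
  then show "(x, y) \<in> strict_R S O strict_L S"
    by (auto simp: strict_R_def strict_L_def intro!: relcompI[of _ "v \<cdot> y"])
qed

section \<open>Eliminating the adjoined identities\<close>

lemma adjoin_ids_right_unit:
  assumes "y \<in> carrier S"
  obtains e where "e \<in> carrier (adjoin_ids S)" "pmult (adjoin_ids S) (Inl y) e = Some (Inl y)"
proof (cases "\<exists>e. local_identity S (rho S y) e")
  \<comment> \<open>An index that already has an identity receives no new one, so the unit has to be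
    the old \<open>e\<close>.\<close>
  case True
  then obtain e where "e \<in> carrier S" "pmult S y e = Some y"
    using assms by (auto simp: local_identity_def hom_set_def)
  then show thesis
    by (intro that[of "Inl e"]) (auto simp: adjoin_ids_def)
next
  case False
  then show thesis
    using assms by (intro that[of "Inr (rho S y)"]) (auto simp: adjoin_ids_def rho_in)
qed

lemma adjoin_ids_left_unit:
  assumes "y \<in> carrier S"
  obtains e where "e \<in> carrier (adjoin_ids S)" "pmult (adjoin_ids S) e (Inl y) = Some (Inl y)"
proof (cases "\<exists>e. local_identity S (lam S y) e")
  case True
  then obtain e where "e \<in> carrier S" "pmult S e y = Some y"
    using assms by (auto simp: local_identity_def hom_set_def)
  then show thesis
    by (intro that[of "Inl e"]) (auto simp: adjoin_ids_def)
next
  case False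
  then show thesis
    using assms by (intro that[of "Inr (lam S y)"]) (auto simp: adjoin_ids_def lam_in)
qed

text \<open>An honest multiplier gives a strict pair, an adjoined identity a trivial one. Membership
  of \<open>y\<close> is spelled out because the reflexive closure contains every diagonal
  pair.\<close>

lemma le_R_iff: "le_R S x y \<longleftrightarrow> y \<in> carrier S \<and> (x, y) \<in> (strict_R S)\<^sup>="
proof
  assume "le_R S x y"
  then show "y \<in> carrier S \<and> (x, y) \<in> (strict_R S)\<^sup>="
    by (auto simp: le_R_def adjoin_ids_def strict_R_def pmult_eq_Some_iff split: if_splits)
next
  assume xy: "y \<in> carrier S \<and> (x, y) \<in> (strict_R S)\<^sup>="
  show "le_R S x y"
  proof (cases "x = y")
    case True
    then show ?thesis
      using xy by (auto simp: le_R_def elim: adjoin_ids_right_unit)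
  next
    case False
    then obtain u where "x \<in> carrier S" "u \<in> carrier S" "rho S y = lam S u" "x = y \<cdot> u"
      using xy by (auto simp: strict_R_def)
    then show ?thesis
      using xy by (auto simp: le_R_def adjoin_ids_def pmult_eq_Some_iff intro!: bexI[of _ "Inl u"])
  qed
qed

lemma le_L_iff: "le_L S x y \<longleftrightarrow> y \<in> carrier S \<and> (x, y) \<in> (strict_L S)\<^sup>="
proof
  assume "le_L S x y"
  then show "y \<in> carrier S \<and> (x, y) \<in> (strict_L S)\<^sup>="
    by (auto simp: le_L_def adjoin_ids_def strict_L_def pmult_eq_Some_iff split: if_splits)
next
  assume xy: "y \<in> carrier S \<and> (x, y) \<in> (strict_L S)\<^sup>="
  show "le_L S x y"
  proof (cases "x = y")
    case True
    then show ?thesis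
      using xy by (auto simp: le_L_def elim: adjoin_ids_left_unit)
  next
    case False
    then obtain u where "x \<in> carrier S" "u \<in> carrier S" "rho S u = lam S y" "x = u \<cdot> y"
      using xy by (auto simp: strict_L_def)
    then show ?thesis
      using xy by (auto simp: le_L_def adjoin_ids_def pmult_eq_Some_iff intro!: bexI[of _ "Inl u"])
  qed
qed

lemma le_J_iff_le_R_le_L: "le_J S x y \<longleftrightarrow> (\<exists>z. le_R S x z \<and> le_L S z y)"
proof
  assume "le_J S x y"
  then obtain b c w where xy: "x \<in> carrier S" "y \<in> carrier S"
    and b: "b \<in> carrier (adjoin_ids S)" and c: "c \<in> carrier (adjoin_ids S)"
    and w: "pmult (adjoin_ids S) b (Inl y) = Some w" "pmult (adjoin_ids S) w c = Some (Inl x)"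
    by (auto simp: le_J_def pmult3_def bind_eq_Some_conv)
  \<comment> \<open>Of whichever kind \<open>b\<close> is, its product with an original element is
    original, so it can serve as the intermediate \<open>z\<close>.\<close>
  obtain z where z: "w = Inl z" "z \<in> carrier S"
    using b w(1) xy(2) by (cases b) (auto simp: adjoin_ids_def pmult_eq_Some_iff split: if_splits)
  then show "\<exists>z. le_R S x z \<and> le_L S z y"
    using xy b c w by (auto simp: le_R_def le_L_def)
next
  assume "\<exists>z. le_R S x z \<and> le_L S z y"
  then show "le_J S x y"
    by (force simp: le_J_def le_R_def le_L_def pmult3_def)
qed

lemma le_J_iff: "le_J S x y \<longleftrightarrow> y \<in> carrier S \<and> (x, y) \<in> (strict_R S)\<^sup>= O (strict_L S)\<^sup>="
  unfolding le_J_iff_le_R_le_L le_R_iff le_L_iff by (auto simp: strict_L_def)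

section \<open>Basic properties of \<open>R\<close> and \<open>L\<close>\<close>

lemma green_R_iff:
  "(x, y) \<in> green_R S \<longleftrightarrow> x \<in> carrier S \<and> (x = y \<or> (x, y) \<in> strict_R S \<and> (y, x) \<in> strict_R S)"
  by (auto simp: green_R_def le_R_iff strict_R_def)

lemma green_L_iff:
  "(x, y) \<in> green_L S \<longleftrightarrow> x \<in> carrier S \<and> (x = y \<or> (x, y) \<in> strict_L S \<and> (y, x) \<in> strict_L S)"
  by (auto simp: green_L_def le_L_iff strict_L_def)

lemma strict_RI:
  "\<lbrakk>y \<in> carrier S; u \<in> carrier S; rho S y = lam S u\<rbrakk> \<Longrightarrow> (y \<cdot> u, y) \<in> strict_R S"
  by (auto simp: strict_R_def)

lemma strict_LI:
  "\<lbrakk>y \<in> carrier S; u \<in> carrier S; rho S u = lam S y\<rbrakk> \<Longrightarrow> (u \<cdot> y, y) \<in> strict_L S"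
  by (auto simp: strict_L_def)

lemma green_R_refl: "x \<in> carrier S \<Longrightarrow> (x, x) \<in> green_R S"
  by (simp add: green_R_iff)

lemma green_L_refl: "x \<in> carrier S \<Longrightarrow> (x, x) \<in> green_L S"
  by (simp add: green_L_iff)

lemma green_R_sym: "(x, y) \<in> green_R S \<Longrightarrow> (y, x) \<in> green_R S"
  by (auto simp: green_R_def)

lemma green_L_sym: "(x, y) \<in> green_L S \<Longrightarrow> (y, x) \<in> green_L S"
  by (auto simp: green_L_def)

lemma green_R_carrier: "(x, y) \<in> green_R S \<Longrightarrow> x \<in> carrier S \<and> y \<in> carrier S \<and> lam S y = lam S x"
  by (auto simp: green_R_iff strict_R_def)

lemma green_L_carrier: "(x, y) \<in> green_L S \<Longrightarrow> x \<in> carrier S \<and> y \<in> carrier S \<and> rho S y = rho S x"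
  by (auto simp: green_L_iff strict_L_def)

lemma green_R_trans: "trans (green_R S)"
  using strict_R_trans by (intro transI) (auto simp: green_R_iff dest: transD)

lemma green_L_trans: "trans (green_L S)"
  using strict_L_trans by (intro transI) (auto simp: green_L_iff dest: transD)

text \<open>Going from \<open>x\<close> to \<open>y\<close> and back composes two honest
  multipliers. Contrapositively, an element not strictly below itself has a trivial class.\<close>

lemma green_R_imp_strict: "(x, y) \<in> green_R S \<Longrightarrow> x \<noteq> y \<Longrightarrow> (x, x) \<in> strict_R S"
  using strict_R_trans by (auto simp: green_R_iff dest: transD)

lemma green_L_imp_strict: "(x, y) \<in> green_L S \<Longrightarrow> x \<noteq> y \<Longrightarrow> (x, x) \<in> strict_L S"
  using strict_L_trans by (auto simp: green_L_iff dest: transD)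

section \<open>Congruence properties and the relation \<open>D\<close>\<close>

lemma strict_L_mul_right:
  assumes "(x, y) \<in> strict_L S" "u \<in> carrier S" "rho S y = lam S u"
  shows "(x \<cdot> u, y \<cdot> u) \<in> strict_L S"
  using assms by (auto simp: strict_L_def)

lemma strict_R_mul_left:
  assumes "(x, y) \<in> strict_R S" "u \<in> carrier S" "rho S u = lam S y"
  shows "(u \<cdot> x, u \<cdot> y) \<in> strict_R S"
  using assms by (auto simp: strict_R_def)

lemma green_L_mul_right:
  assumes "(x, y) \<in> green_L S" "u \<in> carrier S" "rho S x = lam S u"
  shows "(x \<cdot> u, y \<cdot> u) \<in> green_L S"
  using assms strict_L_mul_right[of x y u] strict_L_mul_right[of y x u] green_L_carrier[of x y]
  by (auto simp: green_L_iff)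

lemma green_R_mul_left:
  assumes "(x, y) \<in> green_R S" "u \<in> carrier S" "rho S u = lam S x"
  shows "(u \<cdot> x, u \<cdot> y) \<in> green_R S"
  using assms strict_R_mul_left[of x y u] strict_R_mul_left[of y x u] green_R_carrier[of x y]
  by (auto simp: green_R_iff)

text \<open>The usual square argument: if \<open>x = z v\<close> and \<open>y = q z\<close>, the
  fourth corner is \<open>q z v\<close>. Equalities are split off first because they provide no
  honest multiplier.\<close>

lemma green_R_L_commute: "green_R S O green_L S = green_L S O green_R S"
proof (intro subset_antisym subrelI)
  fix x y assume "(x, y) \<in> green_R S O green_L S"
  then obtain z where xz: "(x, z) \<in> green_R S" and zy: "(z, y) \<in> green_L S"
    by blast
  show "(x, y) \<in> green_L S O green_R S"
  proof (cases "x = z \<or> z = y")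
    case True
    then show ?thesis
      using xz zy green_R_carrier green_L_carrier green_R_refl green_L_refl by blast
  next
    case False
    then obtain v q where v: "v \<in> carrier S" "rho S z = lam S v" "x = z \<cdot> v"
      and q: "q \<in> carrier S" "rho S q = lam S z" "y = q \<cdot> z"
      using xz zy by (auto simp: green_R_iff green_L_iff strict_R_def strict_L_def)
    have z: "z \<in> carrier S"
      using green_R_carrier[OF xz] by auto
    \<comment> \<open>Right multiplication by \<open>v\<close> preserves \<open>L\<close> and takes
      \<open>(z, y)\<close> to \<open>(x, y v)\<close>.\<close>
    have "(x, y \<cdot> v) \<in> green_L S"
      using green_L_mul_right[OF zy v(1,2)] v(3) by simp
    \<comment> \<open>Left multiplication by \<open>q\<close> preserves \<open>R\<close> and takes
      \<open>(x, z)\<close> to \<open>(y v, y)\<close>.\<close>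
    moreover have "(y \<cdot> v, y) \<in> green_R S"
      using green_R_mul_left[OF xz q(1)] z v q by simp
    ultimately show ?thesis
      by blast
  qed
next
  fix x y assume "(x, y) \<in> green_L S O green_R S"
  then obtain z where xz: "(x, z) \<in> green_L S" and zy: "(z, y) \<in> green_R S"
    by blast
  show "(x, y) \<in> green_R S O green_L S"
  proof (cases "x = z \<or> z = y")
    case True
    then show ?thesis
      using xz zy green_R_carrier green_L_carrier green_R_refl green_L_refl by blast
  next
    case False
    then obtain v q where v: "v \<in> carrier S" "rho S z = lam S v" "y = z \<cdot> v"
      and q: "q \<in> carrier S" "rho S q = lam S z" "x = q \<cdot> z"
      using xz zy by (auto simp: green_R_iff green_L_iff strict_R_def strict_L_def)
    have z: "z \<in> carrier S"
      using green_L_carrier[OF xz] by auto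
    have "(x, q \<cdot> y) \<in> green_R S"
      using green_R_mul_left[OF zy q(1,2)] q(3) by simp
    moreover have "(q \<cdot> y, y) \<in> green_L S"
      using green_L_mul_right[OF xz v(1)] z v q by simp
    ultimately show ?thesis
      by blast
  qed
qed

text \<open>By commutation the composite absorbs one further \<open>R\<close>- or
  \<open>L\<close>-step in front, so the transitive closure never leaves it.\<close>

lemma green_D_eq: "green_D S = green_R S O green_L S"
proof
  have absorb: "green_R S O green_R S \<subseteq> green_R S" "green_L S O green_L S \<subseteq> green_L S"
    by (simp_all add: trans_O_subset green_R_trans green_L_trans)
  have "green_R S O green_R S O green_L S \<subseteq> green_R S O green_L S"
    using absorb(1) by blast
  moreover have "green_L S O green_R S O green_L S \<subseteq> green_R S O green_L S"
    using absorb(2) green_R_L_commute by blast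
  ultimately have step: "(green_R S \<union> green_L S) O (green_R S O green_L S) \<subseteq> green_R S O green_L S"
    by blast
  have base: "green_R S \<union> green_L S \<subseteq> green_R S O green_L S"
  proof (rule subrelI)
    fix x y assume "(x, y) \<in> green_R S \<union> green_L S"
    then show "(x, y) \<in> green_R S O green_L S"
      using green_R_carrier green_L_carrier green_R_refl green_L_refl by blast
  qed
  show "green_D S \<subseteq> green_R S O green_L S"
    unfolding green_D_def
  proof (rule subrelI)
    fix x y assume "(x, y) \<in> (green_R S \<union> green_L S)\<^sup>+"
    then show "(x, y) \<in> green_R S O green_L S"
      using base step by (induction rule: converse_trancl_induct) blast+
  qed
  show "green_R S O green_L S \<subseteq> green_D S"
    unfolding green_D_def by (blast intro: trancl_trans)
qed

section \<open>Strictness and the relation \<open>J\<close>\<close>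

lemma le_J_trans_strict: "le_J S x y \<Longrightarrow> (y, z) \<in> strict_J S \<Longrightarrow> (x, z) \<in> strict_J S"
proof -
  assume "le_J S x y" "(y, z) \<in> strict_J S"
  then obtain w where w: "(x, w) \<in> (strict_R S)\<^sup>=" "(w, y) \<in> (strict_L S)\<^sup>="
    and yz: "(y, z) \<in> strict_L S O strict_R S"
    unfolding le_J_iff strict_J_def strict_R_L_commute by blast
  \<comment> \<open>With the strict pair written in the order \<open>L\<close>, \<open>R\<close>,
    its \<open>L\<close>-step meets the weak \<open>L\<close>-step before it; commuting back does
    the same for \<open>R\<close>.\<close>
  have "(w, z) \<in> strict_L S O strict_R S"
    using w(2) yz strict_L_trans by (auto dest: transD)
  then have "(w, z) \<in> strict_R S O strict_L S"
    by (simp add: strict_R_L_commute)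
  then show "(x, z) \<in> strict_J S"
    using w(1) strict_R_trans by (auto simp: strict_J_def dest: transD)
qed

lemma strict_J_trans_le: "(x, y) \<in> strict_J S \<Longrightarrow> le_J S y z \<Longrightarrow> (x, z) \<in> strict_J S"
proof -
  assume "(x, y) \<in> strict_J S" "le_J S y z"
  then obtain w where w: "(y, w) \<in> (strict_R S)\<^sup>=" "(w, z) \<in> (strict_L S)\<^sup>="
    and xy: "(x, y) \<in> strict_L S O strict_R S"
    unfolding le_J_iff strict_J_def strict_R_L_commute by blast
  have "(x, w) \<in> strict_L S O strict_R S"
    using w(1) xy strict_R_trans by (auto dest: transD)
  then have "(x, w) \<in> strict_R S O strict_L S"
    by (simp add: strict_R_L_commute)
  then show "(x, z) \<in> strict_J S"
    using w(2) strict_L_trans by (auto simp: strict_J_def dest: transD)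
qed

lemma strict_J_imp_le_J: "(x, y) \<in> strict_J S \<Longrightarrow> le_J S x y"
  by (auto simp: strict_J_def le_J_iff strict_L_def)

text \<open>In the chain \<open>y\<close>, \<open>x\<close>, \<open>x\<close>, \<open>y\<close> of
  \<open>J\<close>-comparisons the middle link is strict, and one strict link makes the whole chain
  strict.\<close>

lemma green_J_strict:
  "(x, y) \<in> green_J S \<Longrightarrow> (x, x) \<in> strict_J S \<Longrightarrow> (y, y) \<in> strict_J S"
  unfolding green_J_def using le_J_trans_strict strict_J_trans_le by blast

lemma le_J_cases:
  assumes "le_J S x y"
  obtains "(x, y) \<in> strict_J S" | "(x, y) \<in> strict_R S" | "(x, y) \<in> strict_L S" | "x = y"
  using assms unfolding le_J_iff strict_J_def by blast

lemma strict_R_L_imp_J: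
  assumes "(x, y) \<in> strict_R S" "(y, z) \<in> strict_L S"
  shows "(x, z) \<in> strict_J S"
  using assms by (auto simp: strict_J_def)

lemma strict_L_R_imp_J:
  assumes "(x, y) \<in> strict_L S" "(y, z) \<in> strict_R S"
  shows "(x, z) \<in> strict_J S"
  using assms by (auto simp: strict_J_def strict_R_L_commute)

text \<open>\<open>le_J\<close> is split as \<open>R\<close> before \<open>L\<close>; reading the
  reversed pair in that order calls for the factorisation of \<open>D\<close> as \<open>L\<close>
  before \<open>R\<close>.\<close>

lemma green_D_subset_J: "green_D S \<subseteq> green_J S"
proof (rule subrelI)
  fix x y assume "(x, y) \<in> green_D S"
  then obtain z w where "(x, z) \<in> green_R S" "(z, y) \<in> green_L S"
    "(x, w) \<in> green_L S" "(w, y) \<in> green_R S"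
    using green_D_eq green_R_L_commute by blast
  then show "(x, y) \<in> green_J S"
    by (auto simp: green_J_def green_R_def green_L_def le_J_iff_le_R_le_L)
qed

lemma green_J_imp_D:
  assumes "(x, y) \<in> green_J S" and nx: "(x, x) \<notin> strict_J S"
  shows "(x, y) \<in> green_D S"
proof -
  have xy: "le_J S x y" and yx: "le_J S y x" and x: "x \<in> carrier S" and y: "y \<in> carrier S"
    using assms(1) by (auto simp: green_J_def le_J_def)
  \<comment> \<open>A strict \<open>J\<close>-comparison in either direction would close up to
    \<open>(x, x) \<in> strict_J S\<close>.\<close>
  have "(x, y) \<notin> strict_J S" "(y, x) \<notin> strict_J S"
    using nx xy yx strict_J_trans_le le_J_trans_strict by blast+
  \<comment> \<open>So would an \<open>R\<close>-step one way with an \<open>L\<close>-step back.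
    What survives is two \<open>R\<close>-steps, two \<open>L\<close>-steps or equality.\<close>
  moreover have "\<not> ((x, y) \<in> strict_R S \<and> (y, x) \<in> strict_L S)"
    "\<not> ((x, y) \<in> strict_L S \<and> (y, x) \<in> strict_R S)"
    using nx strict_R_L_imp_J strict_L_R_imp_J by blast+
  moreover have "(x, y) \<in> strict_J S \<or> (x, y) \<in> strict_R S \<or> (x, y) \<in> strict_L S \<or> x = y"
    "(y, x) \<in> strict_J S \<or> (y, x) \<in> strict_R S \<or> (y, x) \<in> strict_L S \<or> x = y"
    using xy yx by (blast elim: le_J_cases)+
  ultimately have "(x, y) \<in> green_R S \<or> (x, y) \<in> green_L S"
    using x unfolding green_R_iff green_L_iff by blast
  then show ?thesis
    by (auto simp: green_D_def)
qed

end

section \<open>Sandwich semigroups\<close>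

locale sandwich_semigroup = partial_semigroup S for S :: "('a, 'i) psgp" +
  fixes i j :: 'i and a :: 'a
  assumes a_hom: "a \<in> hom_set S j i"
begin

abbreviation T :: "('a, unit) psgp" where "T \<equiv> sandwich S i j a"

text \<open>Makes everything shown above for partial semigroups available for the sandwich semigroup
  under the prefix \<open>T\<close>.\<close>

sublocale T: partial_semigroup T
  using a_hom by (rule partial_semigroup_sandwich)

lemma a_simps [simp]: "a \<in> carrier S" "lam S a = j" "rho S a = i"
  using a_hom by (auto simp: hom_set_def)

lemma carrier_T [simp]: "carrier T = hom_set S i j"
  by (simp add: sandwich_def)

lemma hom_setI: "\<lbrakk>x \<in> carrier S; lam S x = i; rho S x = j\<rbrakk> \<Longrightarrow> x \<in> hom_set S i j"
  by (simp add: hom_set_def)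

lemma mul_hom_set [simp]:
  assumes "x \<in> carrier S" "y \<in> carrier S" "rho S x = lam S y" "lam S x = i" "rho S y = j"
  shows "x \<cdot> y \<in> hom_set S i j"
  using assms by (simp add: hom_set_def)

lemma hom_set_simps [simp]:
  assumes "x \<in> hom_set S i j"
  shows "x \<in> carrier S" "lam S x = i" "rho S x = j"
  using assms by (simp_all add: hom_set_def)

text \<open>The right-nested form follows the direction of \<open>mul_assoc\<close>, so products in
  \<open>T\<close> and in \<open>S\<close> share one normal form.\<close>

lemma mul_T [simp]:
  assumes "x \<in> hom_set S i j" "y \<in> hom_set S i j"
  shows "pprod T x y = x \<cdot> (a \<cdot> y)"
proof -
  have "pmult3 S x a y = Some (x \<cdot> a \<cdot> y)"
    using assms by (simp add: pmult3_def pmult_eq)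
  moreover have "pprod T x y = the (pmult3 S x a y)"
    by (simp add: pprod_def sandwich_def)
  ultimately show ?thesis
    using assms by simp
qed

section \<open>Strict divisibility in \<open>T\<close> and its passage to \<open>S\<close>\<close>

lemma strict_R_T_iff:
  "(x, y) \<in> strict_R T \<longleftrightarrow> x \<in> hom_set S i j \<and> y \<in> hom_set S i j \<and>
     (\<exists>u \<in> hom_set S i j. x = y \<cdot> (a \<cdot> u))"
  by (auto simp: strict_R_def)

lemma strict_L_T_iff:
  "(x, y) \<in> strict_L T \<longleftrightarrow> x \<in> hom_set S i j \<and> y \<in> hom_set S i j \<and>
     (\<exists>u \<in> hom_set S i j. x = u \<cdot> (a \<cdot> y))"
  by (auto simp: strict_L_def)

lemma strict_J_T_iff:
  "(x, y) \<in> strict_J T \<longleftrightarrow> x \<in> hom_set S i j \<and> y \<in> hom_set S i j \<and>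
     (\<exists>u \<in> hom_set S i j. \<exists>v \<in> hom_set S i j. x = u \<cdot> (a \<cdot> (y \<cdot> (a \<cdot> v))))"
proof
  assume "(x, y) \<in> strict_J T"
  then obtain z where "(x, z) \<in> strict_R T" "(z, y) \<in> strict_L T"
    by (auto simp: strict_J_def)
  then show "x \<in> hom_set S i j \<and> y \<in> hom_set S i j \<and>
     (\<exists>u \<in> hom_set S i j. \<exists>v \<in> hom_set S i j. x = u \<cdot> (a \<cdot> (y \<cdot> (a \<cdot> v))))"
    by (force simp: strict_R_T_iff strict_L_T_iff)
next
  assume "x \<in> hom_set S i j \<and> y \<in> hom_set S i j \<and>
     (\<exists>u \<in> hom_set S i j. \<exists>v \<in> hom_set S i j. x = u \<cdot> (a \<cdot> (y \<cdot> (a \<cdot> v))))"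
  then obtain u v where "x \<in> hom_set S i j" "y \<in> hom_set S i j" "u \<in> hom_set S i j" "v \<in> hom_set S i j"
    "u \<cdot> (a \<cdot> (y \<cdot> (a \<cdot> v))) = x"
    by blast
  then have "(x, u \<cdot> (a \<cdot> y)) \<in> strict_R T" "(u \<cdot> (a \<cdot> y), y) \<in> strict_L T"
    by (auto simp: strict_R_T_iff strict_L_T_iff)
  then show "(x, y) \<in> strict_J T"
    by (auto simp: strict_J_def)
qed

lemma strict_R_T_imp: "(x, y) \<in> strict_R T \<Longrightarrow> (x, y) \<in> strict_R S"
proof -
  assume "(x, y) \<in> strict_R T"
  then obtain u where "x \<in> hom_set S i j" "y \<in> hom_set S i j" "u \<in> hom_set S i j" "x = y \<cdot> (a \<cdot> u)"
    unfolding strict_R_T_iff by blast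
  moreover from this have "a \<cdot> u \<in> carrier S" "rho S y = lam S (a \<cdot> u)"
    by simp_all
  ultimately show ?thesis
    unfolding strict_R_def hom_set_def by blast
qed

lemma strict_L_T_imp: "(x, y) \<in> strict_L T \<Longrightarrow> (x, y) \<in> strict_L S"
proof -
  assume "(x, y) \<in> strict_L T"
  then obtain u where "x \<in> hom_set S i j" "y \<in> hom_set S i j" "u \<in> hom_set S i j" "x = u \<cdot> (a \<cdot> y)"
    unfolding strict_L_T_iff by blast
  moreover from this have "u \<cdot> a \<in> carrier S" "rho S (u \<cdot> a) = lam S y" "x = u \<cdot> a \<cdot> y"
    by simp_all
  ultimately show ?thesis
    unfolding strict_L_def hom_set_def by blast
qed

lemma green_R_T_imp: "(x, y) \<in> green_R T \<Longrightarrow> (x, y) \<in> green_R S"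
  by (auto simp: T.green_R_iff green_R_iff intro: strict_R_T_imp)

lemma green_L_T_imp: "(x, y) \<in> green_L T \<Longrightarrow> (x, y) \<in> green_L S"
  by (auto simp: T.green_L_iff green_L_iff intro: strict_L_T_imp)

lemma le_J_T_imp:
  assumes "le_J T x y"
  shows "le_J S x y"
proof -
  obtain z where "y \<in> hom_set S i j" "(x, z) \<in> (strict_R T)\<^sup>=" "(z, y) \<in> (strict_L T)\<^sup>="
    using assms by (auto simp: T.le_J_iff)
  then have "y \<in> carrier S" "(x, z) \<in> (strict_R S)\<^sup>=" "(z, y) \<in> (strict_L S)\<^sup>="
    using strict_R_T_imp[of x z] strict_L_T_imp[of z y] by auto
  then show ?thesis
    by (auto simp: le_J_iff)
qed

lemma strict_R_TI:
  "\<lbrakk>y \<in> hom_set S i j; u \<in> hom_set S i j\<rbrakk> \<Longrightarrow> (y \<cdot> (a \<cdot> u), y) \<in> strict_R T"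
  unfolding strict_R_T_iff by auto

lemma strict_L_TI:
  "\<lbrakk>y \<in> hom_set S i j; u \<in> hom_set S i j\<rbrakk> \<Longrightarrow> (u \<cdot> (a \<cdot> y), y) \<in> strict_L T"
  unfolding strict_L_T_iff by auto

lemma strict_J_TI:
  "\<lbrakk>y \<in> hom_set S i j; u \<in> hom_set S i j; v \<in> hom_set S i j\<rbrakk>
    \<Longrightarrow> (u \<cdot> (a \<cdot> (y \<cdot> (a \<cdot> v))), y) \<in> strict_J T"
  unfolding strict_J_T_iff by auto

section \<open>\<open>P1\<close> and \<open>P2\<close> as regularity conditions in
  \<open>T\<close>\<close>

lemma a_hom_set: "i = j \<Longrightarrow> a \<in> hom_set S i j"
  using a_hom by simp

text \<open>As \<open>x a\<close> is a right multiple of \<open>x\<close>, only the converse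
  comparison matters: either \<open>x a = x\<close>, or \<open>x = x a u\<close>, which is
  \<open>x \<star> u\<close>.\<close>

lemma P1_iff: "x \<in> P1 S i j a \<longleftrightarrow> (x, x) \<in> strict_R T"
proof (cases "x \<in> hom_set S i j")
  case x: True
  note xs [simp] = hom_set_simps[OF x]
  have "(x \<cdot> a, x) \<in> strict_R S"
    by (intro strict_RI) simp_all
  then have "x \<in> P1 S i j a \<longleftrightarrow> x \<cdot> a = x \<or> (x, x \<cdot> a) \<in> strict_R S"
    using x by (auto simp: P1_def pmult_eq green_R_iff)
  also have "\<dots> \<longleftrightarrow> (x, x) \<in> strict_R T"
  proof (intro iffI, elim disjE)
    \<comment> \<open>Comparing right indices gives \<open>i = j\<close>, so \<open>a\<close> itself
      belongs to \<open>T\<close> and \<open>x = x a a\<close> exhibits it as the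
      multiplier.\<close>
    assume e: "x \<cdot> a = x"
    then have ij: "i = j"
      using rho_mul[of x a] by simp
    then have "x \<cdot> (a \<cdot> a) = x \<cdot> a \<cdot> a"
      by (intro mul_assoc[symmetric]) simp_all
    also have "\<dots> = x"
      by (simp only: e)
    finally show "(x, x) \<in> strict_R T"
      using strict_R_TI[OF x a_hom_set[OF ij]] by simp
  next
    assume "(x, x \<cdot> a) \<in> strict_R S"
    then obtain u where u: "u \<in> carrier S" "lam S u = i" "x \<cdot> (a \<cdot> u) = x"
      by (auto simp: strict_R_def)
    \<comment> \<open>The right index of \<open>u\<close> is read off from the product
      \<open>x\<close>, which puts \<open>u\<close> into \<open>T\<close>.\<close>
    then have "rho S u = j"
      using rho_mul[of x "a \<cdot> u"] by simp
    with u have "u \<in> hom_set S i j"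
      by (intro hom_setI)
    from strict_R_TI[OF x this] u show "(x, x) \<in> strict_R T"
      by simp
  next
    assume "(x, x) \<in> strict_R T"
    then obtain u where u: "u \<in> hom_set S i j" "x \<cdot> (a \<cdot> u) = x"
      by (metis strict_R_T_iff)
    then have "(x \<cdot> a \<cdot> u, x \<cdot> a) \<in> strict_R S"
      by (intro strict_RI) simp_all
    with u show "x \<cdot> a = x \<or> (x, x \<cdot> a) \<in> strict_R S"
      by simp
  qed
  finally show ?thesis .
qed (auto simp: P1_def strict_R_T_iff)

text \<open>Mirror image of \<open>P1_iff\<close>; right nesting already exposes the factor
  \<open>a \<cdot> x\<close>, so no regrouping occurs.\<close>

lemma P2_iff: "x \<in> P2 S i j a \<longleftrightarrow> (x, x) \<in> strict_L T"
proof (cases "x \<in> hom_set S i j")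
  case x: True
  note xs [simp] = hom_set_simps[OF x]
  have "(a \<cdot> x, x) \<in> strict_L S"
    by (intro strict_LI) simp_all
  then have "x \<in> P2 S i j a \<longleftrightarrow> a \<cdot> x = x \<or> (x, a \<cdot> x) \<in> strict_L S"
    using x by (auto simp: P2_def pmult_eq green_L_iff)
  also have "\<dots> \<longleftrightarrow> (x, x) \<in> strict_L T"
  proof (intro iffI, elim disjE)
    assume e: "a \<cdot> x = x"
    then have ij: "i = j"
      using lam_mul[of a x] by simp
    from e show "(x, x) \<in> strict_L T"
      using strict_L_TI[OF x a_hom_set[OF ij]] by simp
  next
    assume "(x, a \<cdot> x) \<in> strict_L S"
    then obtain u where u: "u \<in> carrier S" "rho S u = j" "u \<cdot> (a \<cdot> x) = x"
      by (auto simp: strict_L_def)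
    then have "lam S u = i"
      using lam_mul[of u "a \<cdot> x"] by simp
    with u have "u \<in> hom_set S i j"
      by (intro hom_setI)
    from strict_L_TI[OF x this] u show "(x, x) \<in> strict_L T"
      by simp
  next
    assume "(x, x) \<in> strict_L T"
    then obtain u where u: "u \<in> hom_set S i j" "u \<cdot> (a \<cdot> x) = x"
      by (metis strict_L_T_iff)
    then have "(u \<cdot> (a \<cdot> x), a \<cdot> x) \<in> strict_L S"
      by (intro strict_LI) simp_all
    with u show "a \<cdot> x = x \<or> (x, a \<cdot> x) \<in> strict_L S"
      by simp
  qed
  finally show ?thesis .
qed (auto simp: P2_def strict_L_T_iff)

section \<open>Lifting divisibility from \<open>S\<close> to \<open>T\<close>, and
  \<open>P3\<close>\<close>

lemma strict_R_T_insert: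
  assumes "(x, y) \<in> strict_R S" "(y, y) \<in> strict_R T" "x \<in> hom_set S i j"
  shows "(x, y) \<in> strict_R T"
proof -
  obtain u where u: "u \<in> carrier S" "rho S y = lam S u" "y \<cdot> u = x"
    using assms(1) by (auto simp: strict_R_def)
  obtain w where w: "w \<in> hom_set S i j" "y \<in> hom_set S i j" "y \<cdot> (a \<cdot> w) = y"
    using assms(2) by (metis strict_R_T_iff)
  \<comment> \<open>Both indices of \<open>u\<close> are \<open>j\<close>, which keeps
    \<open>w \<cdot> u\<close> in \<open>hom_set S i j\<close>.\<close>
  have "lam S u = j"
    using u(2) w(2) by simp
  moreover have "rho S u = j"
    using u w(2) assms(3) rho_mul[of y u] by simp
  moreover have "y \<cdot> (a \<cdot> (w \<cdot> u)) = y \<cdot> (a \<cdot> w) \<cdot> u"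
    using u(1) w(1,2) calculation by simp
  \<comment> \<open>Only these two equations are used: the associativity rule would regroup the
    right side and hide the factor \<open>y \<cdot> (a \<cdot> w)\<close>.\<close>
  then have "y \<cdot> (a \<cdot> (w \<cdot> u)) = x"
    by (simp only: u(3) w(3))
  ultimately show ?thesis
    using u(1) w(1,2) strict_R_TI[of y "w \<cdot> u"] by simp
qed

lemma strict_L_T_insert:
  assumes "(x, y) \<in> strict_L S" "(y, y) \<in> strict_L T" "x \<in> hom_set S i j"
  shows "(x, y) \<in> strict_L T"
proof -
  obtain u where u: "u \<in> carrier S" "rho S u = lam S y" "u \<cdot> y = x"
    using assms(1) by (auto simp: strict_L_def)
  obtain w where w: "w \<in> hom_set S i j" "y \<in> hom_set S i j" "w \<cdot> (a \<cdot> y) = y"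
    using assms(2) by (metis strict_L_T_iff)
  have "rho S u = i"
    using u(2) w(2) by simp
  moreover have "lam S u = i"
    using u w(2) assms(3) lam_mul[of u y] by simp
  moreover have "u \<cdot> w \<cdot> (a \<cdot> y) = u \<cdot> (w \<cdot> (a \<cdot> y))"
    using u(1) w(1,2) calculation by simp
  then have "u \<cdot> w \<cdot> (a \<cdot> y) = x"
    by (simp only: u(3) w(3))
  ultimately show ?thesis
    using u(1) w(1,2) strict_L_TI[of y "u \<cdot> w"] by simp
qed

text \<open>One side at a time: in \<open>y = u a y a v\<close> the left multiplier leading to
  \<open>x\<close> is absorbed into \<open>u\<close>, then the right one into \<open>v\<close>. A
  weak comparison thus becomes strict.\<close>

lemma strict_J_T_insert:
  assumes "le_J S x y" "(y, y) \<in> strict_J T" "x \<in> hom_set S i j"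
  shows "(x, y) \<in> strict_J T"
proof -
  obtain u v where uv: "u \<in> hom_set S i j" "v \<in> hom_set S i j" "y \<in> hom_set S i j"
    and y: "u \<cdot> (a \<cdot> (y \<cdot> (a \<cdot> v))) = y"
    using assms(2) by (metis strict_J_T_iff)
  obtain z where xz: "x = z \<or> (x, z) \<in> strict_R S" and zy: "z = y \<or> (z, y) \<in> strict_L S"
    using assms(1) by (auto simp: le_J_iff)
  \<comment> \<open>\<open>z\<close> shares its left index with \<open>x\<close> and its right index
    with \<open>y\<close>.\<close>
  have "z \<in> carrier S" "lam S z = lam S x" "rho S z = rho S y"
    using xz zy strict_RD[of x z] strict_LD[of z y] hom_set_simps(1)[OF uv(3)] by metis+
  then have z: "z \<in> hom_set S i j"
    using assms(3) uv(3) by (intro hom_setI) simp_all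
  have "\<exists>u' \<in> hom_set S i j. u' \<cdot> (a \<cdot> (y \<cdot> (a \<cdot> v))) = z"
    using zy
  proof
    assume "(z, y) \<in> strict_L S"
    then obtain s where s: "s \<in> carrier S" "rho S s = lam S y" "s \<cdot> y = z"
      by (auto simp: strict_L_def)
    have "rho S s = i" "lam S s = i"
      using s z uv(3) lam_mul[of s y] by simp_all
    moreover from this have "s \<cdot> u \<cdot> (a \<cdot> (y \<cdot> (a \<cdot> v))) = s \<cdot> (u \<cdot> (a \<cdot> (y \<cdot> (a \<cdot> v))))"
      using s(1) uv by (intro mul_assoc) simp_all
    ultimately show ?thesis
      using s(1) uv by (intro bexI[of _ "s \<cdot> u"]) (simp_all only: y s(3) mul_hom_set hom_set_simps)
  qed (use uv y in blast)
  then obtain u' where u': "u' \<in> hom_set S i j" "u' \<cdot> (a \<cdot> (y \<cdot> (a \<cdot> v))) = z"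
    by blast
  have "\<exists>v' \<in> hom_set S i j. u' \<cdot> (a \<cdot> (y \<cdot> (a \<cdot> v'))) = x"
    using xz
  proof
    assume "(x, z) \<in> strict_R S"
    then obtain t where t: "t \<in> carrier S" "rho S z = lam S t" "z \<cdot> t = x"
      by (auto simp: strict_R_def)
    have "lam S t = j" "rho S t = j"
      using t z assms(3) rho_mul[of z t] by simp_all
    moreover from this have "u' \<cdot> (a \<cdot> (y \<cdot> (a \<cdot> (v \<cdot> t)))) = u' \<cdot> (a \<cdot> (y \<cdot> (a \<cdot> v))) \<cdot> t"
      using t(1) u'(1) uv by simp
    ultimately show ?thesis
      using t(1) uv by (intro bexI[of _ "v \<cdot> t"]) (simp_all only: u'(2) t(3) mul_hom_set hom_set_simps)
  qed (use u' uv in blast)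
  then show ?thesis
    using u' uv assms(3) by (metis strict_J_T_iff)
qed

text \<open>\<open>a x a\<close> is always below \<open>x\<close>, so the question is whether
  \<open>x = s (a x a) t\<close> with \<open>s\<close>, \<open>t\<close> honest or identities; the
  cases are removed by iterating this equation.\<close>

lemma P3_iff: "x \<in> P3 S i j a \<longleftrightarrow> (x, x) \<in> strict_J T"
proof (cases "x \<in> hom_set S i j")
  case x: True
  note xs [simp] = hom_set_simps[OF x]
  let ?q = "a \<cdot> (x \<cdot> a)"
  have "(a \<cdot> x \<cdot> a, a \<cdot> x) \<in> strict_R S" "(a \<cdot> x, x) \<in> strict_L S"
    by (intro strict_RI strict_LI; simp)+
  then have "le_J S ?q x"
    using strict_R_L_imp_J strict_J_imp_le_J by fastforce
  then have "x \<in> P3 S i j a \<longleftrightarrow> le_J S x ?q"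
    using x by (auto simp: P3_def pmult3_def pmult_eq green_J_def)
  also have "\<dots> \<longleftrightarrow> (x, x) \<in> strict_J T"
  proof
    assume "le_J S x ?q"
    then obtain z where xz: "x = z \<or> (x, z) \<in> strict_R S" and zq: "z = ?q \<or> (z, ?q) \<in> strict_L S"
      by (auto simp: le_J_iff)
    have "z \<in> carrier S" "lam S z = lam S x" "rho S z = rho S ?q"
      using xz zq strict_RD[of x z] strict_LD[of z ?q] xs(1) by metis+
    then have z: "z \<in> carrier S" "lam S z = i" "rho S z = i"
      by simp_all
    \<comment> \<open>An identity as multiplier leaves the index at its side unchanged, which forces
      \<open>i = j\<close>; then \<open>a\<close> can stand in as a multiplier.\<close>
    have left: "i = j \<and> z = ?q \<or> (\<exists>s \<in> hom_set S i j. s \<cdot> ?q = z)"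
      using zq
    proof
      assume "z = ?q"
      then show ?thesis
        using z(2) by simp
    next
      assume "(z, ?q) \<in> strict_L S"
      then obtain s where s: "s \<in> carrier S" "rho S s = j" "s \<cdot> ?q = z"
        by (auto simp: strict_L_def)
      have "lam S s = i"
        using lam_mul[of s ?q] s(1,2) z(2) unfolding s(3) by simp
      then show ?thesis
        using s hom_setI by blast
    qed
    have right: "i = j \<and> x = z \<or> (\<exists>t \<in> hom_set S i j. z \<cdot> t = x)"
      using xz
    proof
      assume "x = z"
      then show ?thesis
        using z(3) xs(3) by metis
    next
      assume "(x, z) \<in> strict_R S"
      then obtain t where t: "t \<in> carrier S" "rho S z = lam S t" "z \<cdot> t = x"
        by (auto simp: strict_R_def)
      have "lam S t = i"
        using t(2) z(3) by simp
      moreover have "rho S t = j"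
        using rho_mul[OF z(1) t(1,2)] unfolding t(3) by simp
      ultimately show ?thesis
        using t(1,3) hom_setI by blast
    qed
    txt \<open>Substituting \<open>x = s a x a t\<close> into itself gives \<open>x = (s a s) a x a (t a t)\<close>, where \<open>s a s\<close>
      and \<open>t a t\<close> are honest elements even if \<open>s\<close> or \<open>t\<close> is an adjoined identity.\<close>
    from left right consider
        (none) "i = j" "?q = x"
      | (right) t where "i = j" "t \<in> hom_set S i j" "?q \<cdot> t = x"
      | (left) s where "i = j" "s \<in> hom_set S i j" "s \<cdot> ?q = x"
      | (both) s t where "s \<in> hom_set S i j" "t \<in> hom_set S i j" "s \<cdot> ?q \<cdot> t = x"
      by (elim disjE conjE bexE) metis+
    then show "(x, x) \<in> strict_J T"
    proof cases
      case none
      have "a \<cdot> (a \<cdot> (x \<cdot> (a \<cdot> a))) = a \<cdot> (?q \<cdot> a)"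
        by (simp add: none(1))
      also have "\<dots> = x"
        by (simp only: none(2))
      finally show ?thesis
        using strict_J_TI[OF x a_hom_set[OF none(1)] a_hom_set[OF none(1)]] by simp
    next
      case (right t)
      note [simp] = hom_set_simps[OF right(2)]
      \<comment> \<open>Replacing the inner \<open>?q \<cdot> t\<close> by \<open>x\<close> leaves
        \<open>?q \<cdot> t\<close> once more.\<close>
      have "a \<cdot> (a \<cdot> (x \<cdot> (a \<cdot> (t \<cdot> (a \<cdot> t))))) = a \<cdot> (?q \<cdot> t \<cdot> a) \<cdot> t"
        by (simp add: right(1))
      also have "\<dots> = x"
        by (simp only: right(3))
      finally show ?thesis
        using strict_J_TI[OF x a_hom_set[OF right(1)], of "t \<cdot> (a \<cdot> t)"] by simp
    next
      case (left s)
      note [simp] = hom_set_simps[OF left(2)]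
      have "s \<cdot> (a \<cdot> s) \<cdot> (a \<cdot> (x \<cdot> (a \<cdot> a))) = s \<cdot> (a \<cdot> (s \<cdot> ?q \<cdot> a))"
        by (simp add: left(1))
      also have "\<dots> = x"
        by (simp only: left(3))
      finally show ?thesis
        using strict_J_TI[OF x _ a_hom_set[OF left(1)], of "s \<cdot> (a \<cdot> s)"] by simp
    next
      case (both s t)
      note [simp] = hom_set_simps[OF both(1)] hom_set_simps[OF both(2)]
      have sas: "s \<cdot> (a \<cdot> s) \<in> hom_set S i j" and tat: "t \<cdot> (a \<cdot> t) \<in> hom_set S i j"
        by simp_all
      \<comment> \<open>The inner \<open>s \<cdot> ?q \<cdot> t\<close> collapses to
        \<open>x\<close>, and the same product is left.\<close>
      have "s \<cdot> (a \<cdot> s) \<cdot> (a \<cdot> (x \<cdot> (a \<cdot> (t \<cdot> (a \<cdot> t))))) = s \<cdot> (a \<cdot> (s \<cdot> ?q \<cdot> t \<cdot> a)) \<cdot> t"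
        by simp
      also have "\<dots> = x"
        by (simp only: both(3))
      finally show ?thesis
        using strict_J_TI[OF x sas tat] by (simp only:)
    qed
  next
    assume "(x, x) \<in> strict_J T"
    then obtain u v where uv: "u \<in> hom_set S i j" "v \<in> hom_set S i j" "u \<cdot> (a \<cdot> (x \<cdot> (a \<cdot> v))) = x"
      by (metis strict_J_T_iff)
    note [simp] = hom_set_simps[OF uv(1)] hom_set_simps[OF uv(2)]
    have "u \<cdot> ?q \<cdot> v = x"
      using uv(3) by simp
    moreover have "(u \<cdot> ?q \<cdot> v, u \<cdot> ?q) \<in> strict_R S" "(u \<cdot> ?q, ?q) \<in> strict_L S"
      by (intro strict_RI strict_LI; simp)+
    then have "(u \<cdot> ?q \<cdot> v, ?q) \<in> strict_J S"
      by (rule strict_R_L_imp_J)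
    ultimately show "le_J S x ?q"
      by (simp only: strict_J_imp_le_J)
  qed
  finally show ?thesis .
qed (auto simp: P3_def strict_J_T_iff)

section \<open>Comparison of Green's relations of \<open>S\<close> and \<open>T\<close>\<close>

lemma P2_green_R:
  assumes "(x, y) \<in> green_R S" "(x, x) \<in> strict_L T" "y \<in> hom_set S i j"
  shows "(y, y) \<in> strict_L T"
proof (cases "x = y")
  case False
  then obtain u where u: "u \<in> carrier S" "rho S x = lam S u" "x \<cdot> u = y"
    using assms(1) by (auto simp: green_R_iff strict_R_def)
  obtain w where w: "w \<in> hom_set S i j" "x \<in> hom_set S i j" "w \<cdot> (a \<cdot> x) = x"
    using assms(2) by (metis strict_L_T_iff)
  \<comment> \<open>Left multiplication by \<open>w a\<close> fixes \<open>x\<close>, hence also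
    every right multiple of \<open>x\<close>.\<close>
  have "w \<cdot> (a \<cdot> (x \<cdot> u)) = w \<cdot> (a \<cdot> x) \<cdot> u"
    using u(1,2) w(1,2) by simp
  then have "w \<cdot> (a \<cdot> y) = y"
    by (simp only: u(3) w(3))
  then show ?thesis
    using strict_L_TI[OF assms(3) w(1)] by simp
qed (use assms in simp)

text \<open>A right factor \<open>a \<cdot> w\<close> fixing \<open>x\<close> also fixes the left
  multiples of \<open>x\<close>.\<close>

lemma P1_green_L:
  assumes "(x, y) \<in> green_L S" "(x, x) \<in> strict_R T" "y \<in> hom_set S i j"
  shows "(y, y) \<in> strict_R T"
proof (cases "x = y")
  case False
  then obtain u where u: "u \<in> carrier S" "rho S u = lam S x" "u \<cdot> x = y"
    using assms(1) by (auto simp: green_L_iff strict_L_def)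
  obtain w where w: "w \<in> hom_set S i j" "x \<in> hom_set S i j" "x \<cdot> (a \<cdot> w) = x"
    using assms(2) by (metis strict_R_T_iff)
  have "u \<cdot> x \<cdot> (a \<cdot> w) = u \<cdot> (x \<cdot> (a \<cdot> w))"
    using u(1,2) w(1,2) by simp
  then have "y \<cdot> (a \<cdot> w) = y"
    by (simp only: u(3) w(3))
  then show ?thesis
    using strict_R_TI[OF assms(3) w(1)] by simp
qed (use assms in simp)

text \<open>Distinct related elements are each strictly below themselves; conversely, regularity of
  both lifts the two comparisons from \<open>S\<close>.\<close>

lemma green_R_T_iff:
  assumes "x \<in> hom_set S i j"
  shows "(x, y) \<in> green_R T \<longleftrightarrow>
    x = y \<or> y \<in> hom_set S i j \<and> (x, y) \<in> green_R S \<and> (x, x) \<in> strict_R T \<and> (y, y) \<in> strict_R T"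
proof
  assume xy: "(x, y) \<in> green_R T"
  show "x = y \<or> y \<in> hom_set S i j \<and> (x, y) \<in> green_R S \<and> (x, x) \<in> strict_R T \<and> (y, y) \<in> strict_R T"
    using xy green_R_T_imp T.green_R_imp_strict T.green_R_sym T.green_R_carrier carrier_T by metis
next
  assume "x = y \<or> y \<in> hom_set S i j \<and> (x, y) \<in> green_R S \<and> (x, x) \<in> strict_R T \<and> (y, y) \<in> strict_R T"
  then show "(x, y) \<in> green_R T"
    using assms strict_R_T_insert unfolding T.green_R_iff green_R_iff carrier_T by blast
qed

lemma green_L_T_iff:
  assumes "x \<in> hom_set S i j"
  shows "(x, y) \<in> green_L T \<longleftrightarrow>
    x = y \<or> y \<in> hom_set S i j \<and> (x, y) \<in> green_L S \<and> (x, x) \<in> strict_L T \<and> (y, y) \<in> strict_L T"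
proof
  assume xy: "(x, y) \<in> green_L T"
  show "x = y \<or> y \<in> hom_set S i j \<and> (x, y) \<in> green_L S \<and> (x, x) \<in> strict_L T \<and> (y, y) \<in> strict_L T"
    using xy green_L_T_imp T.green_L_imp_strict T.green_L_sym T.green_L_carrier carrier_T by metis
next
  assume "x = y \<or> y \<in> hom_set S i j \<and> (x, y) \<in> green_L S \<and> (x, x) \<in> strict_L T \<and> (y, y) \<in> strict_L T"
  then show "(x, y) \<in> green_L T"
    using assms strict_L_T_insert unfolding T.green_L_iff green_L_iff carrier_T by blast
qed

text \<open>\<open>R\<close> preserves the left index and \<open>L\<close> the right one, so the
  intermediate element of a \<open>D\<close>-pair stays in the same hom-set.\<close>

lemma hom_set_between:
  assumes "(x, z) \<in> green_R S" "(z, y) \<in> green_L S" "x \<in> hom_set S i j" "y \<in> hom_set S i j"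
  shows "z \<in> hom_set S i j"
  using assms green_R_carrier[of x z] green_L_carrier[of z y] by (intro hom_setI) simp_all

lemma green_D_T_regular:
  assumes x: "x \<in> hom_set S i j" and P: "(x, x) \<in> strict_R T" "(x, x) \<in> strict_L T"
  shows "(x, y) \<in> green_D T \<longleftrightarrow>
    y \<in> hom_set S i j \<and> (x, y) \<in> green_D S \<and> (y, y) \<in> strict_R T \<and> (y, y) \<in> strict_L T"
proof
  assume "(x, y) \<in> green_D T"
  then obtain z where xz: "(x, z) \<in> green_R T" and zy: "(z, y) \<in> green_L T"
    by (auto simp: T.green_D_eq)
  have hom: "z \<in> hom_set S i j" "y \<in> hom_set S i j"
    using xz zy T.green_R_carrier T.green_L_carrier by auto
  have S: "(x, z) \<in> green_R S" "(z, y) \<in> green_L S"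
    using xz zy green_R_T_imp green_L_T_imp by auto
  \<comment> \<open>\<open>z\<close> inherits membership in \<open>P1\<close> from its
    \<open>R\<close>-relation to \<open>x\<close> in \<open>T\<close>, and in \<open>P2\<close>
    because that is stable under \<open>R\<close>.\<close>
  have "(z, z) \<in> strict_R T" "(z, z) \<in> strict_L T"
    using xz P P2_green_R[OF S(1) P(2) hom(1)] green_R_T_iff[OF x] by auto
  then have "(y, y) \<in> strict_R T" "(y, y) \<in> strict_L T"
    using zy P1_green_L[OF S(2) _ hom(2)] green_L_T_iff[OF hom(1)] by auto
  then show "y \<in> hom_set S i j \<and> (x, y) \<in> green_D S \<and> (y, y) \<in> strict_R T \<and> (y, y) \<in> strict_L T"
    using hom S by (auto simp: green_D_eq)
next
  assume y: "y \<in> hom_set S i j \<and> (x, y) \<in> green_D S \<and> (y, y) \<in> strict_R T \<and> (y, y) \<in> strict_L T"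
  then obtain z where S: "(x, z) \<in> green_R S" "(z, y) \<in> green_L S"
    by (auto simp: green_D_eq)
  have z: "z \<in> hom_set S i j"
    using hom_set_between[OF S x] y by blast
  \<comment> \<open>\<open>P2\<close> reaches \<open>z\<close> from \<open>x\<close> along
    \<open>R\<close>, and \<open>P1\<close> reaches it from \<open>y\<close> along
    \<open>L\<close>.\<close>
  have "(z, z) \<in> strict_L T" "(z, z) \<in> strict_R T"
    using P2_green_R[OF S(1) P(2) z] P1_green_L[OF green_L_sym[OF S(2)] _ z] y by auto
  then have "(x, z) \<in> green_R T" "(z, y) \<in> green_L T"
    using S P x y z green_R_T_iff[OF x] green_L_T_iff[OF z] by auto
  then show "(x, y) \<in> green_D T"
    by (auto simp: T.green_D_eq)
qed

text \<open>The \<open>R\<close>-class of \<open>x\<close> in \<open>T\<close> is trivial, so a path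
  \<open>R\<close> then \<open>L\<close> from \<open>x\<close> is a single
  \<open>L\<close>-step.\<close>

lemma green_D_T_not_P1:
  assumes "x \<in> hom_set S i j" "(x, x) \<notin> strict_R T"
  shows "(x, y) \<in> green_D T \<longleftrightarrow> (x, y) \<in> green_L T"
  using assms green_R_T_iff[of x] unfolding T.green_D_eq by auto

text \<open>Here the commuted order \<open>L\<close> then \<open>R\<close> puts the trivial step
  first.\<close>

lemma green_D_T_not_P2:
  assumes "x \<in> hom_set S i j" "(x, x) \<notin> strict_L T"
  shows "(x, y) \<in> green_D T \<longleftrightarrow> (x, y) \<in> green_R T"
  using assms green_L_T_iff[of x] unfolding T.green_D_eq T.green_R_L_commute by auto

text \<open>Strictness passes from \<open>x\<close> to \<open>y\<close>; conversely each comparison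
  is lifted by the regularity of its upper element.\<close>

lemma green_J_T_regular:
  assumes x: "x \<in> hom_set S i j" and P: "(x, x) \<in> strict_J T"
  shows "(x, y) \<in> green_J T \<longleftrightarrow> y \<in> hom_set S i j \<and> (x, y) \<in> green_J S \<and> (y, y) \<in> strict_J T"
proof
  assume xy: "(x, y) \<in> green_J T"
  then show "y \<in> hom_set S i j \<and> (x, y) \<in> green_J S \<and> (y, y) \<in> strict_J T"
    using T.green_J_strict[OF xy P] le_J_T_imp[of x y] le_J_T_imp[of y x]
    by (auto simp: green_J_def le_J_def)
next
  assume "y \<in> hom_set S i j \<and> (x, y) \<in> green_J S \<and> (y, y) \<in> strict_J T"
  then show "(x, y) \<in> green_J T"
    using strict_J_T_insert[of x y] strict_J_T_insert[of y x] T.strict_J_imp_le_J x P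
    by (auto simp: green_J_def)
qed

lemma green_J_T_not_P3:
  assumes "(x, x) \<notin> strict_J T"
  shows "(x, y) \<in> green_J T \<longleftrightarrow> (x, y) \<in> green_D T"
  using assms T.green_J_imp_D T.green_D_subset_J by blast

text \<open>An \<open>H\<close>-related \<open>y\<close> inherits \<open>P1\<close> along
  \<open>L\<close> and \<open>P2\<close> along \<open>R\<close>, which is why no intersection with
  \<open>P12\<close> appears for \<open>H\<close>.\<close>

lemma green_H_T_regular:
  assumes "x \<in> hom_set S i j" "(x, x) \<in> strict_R T" "(x, x) \<in> strict_L T" "y \<in> hom_set S i j"
  shows "(x, y) \<in> green_H T \<longleftrightarrow> (x, y) \<in> green_H S"
  using assms P1_green_L[of x y] P2_green_R[of x y] green_R_refl green_L_refl
  unfolding green_H_def Int_iff green_R_T_iff[OF assms(1)] green_L_T_iff[OF assms(1)]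
  by auto

lemma green_H_T_not_P12:
  assumes "x \<in> hom_set S i j" "\<not> ((x, x) \<in> strict_R T \<and> (x, x) \<in> strict_L T)"
  shows "(x, y) \<in> green_H T \<longleftrightarrow> x = y"
  using assms(2) unfolding green_H_def Int_iff green_R_T_iff[OF assms(1)] green_L_T_iff[OF assms(1)]
  by auto

lemma singleton_group_imp_P12:
  assumes x: "x \<in> hom_set S i j" and "is_group_under T {x}"
  shows "(x, x) \<in> strict_R T \<and> (x, x) \<in> strict_L T"
proof -
  obtain e where "group \<lparr>carrier = {x}, monoid.mult = (\<lambda>x y. the (pmult T x y)), one = e\<rparr>"
    using assms(2) by (auto simp: is_group_under_def)
  \<comment> \<open>Closure of the singleton already makes \<open>x\<close> idempotent in
    \<open>T\<close>, so \<open>x\<close> is its own multiplier on either side.\<close>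
  then have "the (pmult T x x) = x"
    using monoid.m_closed[OF group.is_monoid, of _ x x] by fastforce
  then have "x \<cdot> (a \<cdot> x) = x"
    using x mul_T[of x x] by (simp add: pprod_def[of T])
  then show ?thesis
    using strict_R_TI[OF x x] strict_L_TI[OF x x] by simp
qed

end

theorem theorem2p13:
  fixes S :: "('a, 'i) psgp" and i j :: 'i and a x :: 'a
  assumes "partial_semigroup S"
    and "i \<in> indices S" and "j \<in> indices S"
    and "a \<in> hom_set S j i"
    and "x \<in> hom_set S i j"
  shows
    "(x \<in> P1 S i j a \<longrightarrow>
        green_class S i j (green_R (sandwich S i j a)) x
          = green_class S i j (green_R S) x \<inter> P1 S i j a) \<and>
     (x \<in> hom_set S i j - P1 S i j a \<longrightarrow>
        green_class S i j (green_R (sandwich S i j a)) x = {x}) \<and>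

     (x \<in> P2 S i j a \<longrightarrow>
        green_class S i j (green_L (sandwich S i j a)) x
          = green_class S i j (green_L S) x \<inter> P2 S i j a) \<and>
     (x \<in> hom_set S i j - P2 S i j a \<longrightarrow>
        green_class S i j (green_L (sandwich S i j a)) x = {x}) \<and>

     (x \<in> P12 S i j a \<longrightarrow>
        green_class S i j (green_H (sandwich S i j a)) x = green_class S i j (green_H S) x) \<and>
     (x \<in> hom_set S i j - P12 S i j a \<longrightarrow>
        green_class S i j (green_H (sandwich S i j a)) x = {x}) \<and>

     (x \<in> P12 S i j a \<longrightarrow>
        green_class S i j (green_D (sandwich S i j a)) x
          = green_class S i j (green_D S) x \<inter> P12 S i j a) \<and>
     (x \<in> P2 S i j a - P1 S i j a \<longrightarrow>
        green_class S i j (green_D (sandwich S i j a)) x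
          = green_class S i j (green_L (sandwich S i j a)) x) \<and>
     (x \<in> P1 S i j a - P2 S i j a \<longrightarrow>
        green_class S i j (green_D (sandwich S i j a)) x
          = green_class S i j (green_R (sandwich S i j a)) x) \<and>
     (x \<in> hom_set S i j - (P1 S i j a \<union> P2 S i j a) \<longrightarrow>
        green_class S i j (green_D (sandwich S i j a)) x = {x}) \<and>

     (x \<in> P3 S i j a \<longrightarrow>
        green_class S i j (green_J (sandwich S i j a)) x
          = green_class S i j (green_J S) x \<inter> P3 S i j a) \<and>
     (x \<in> hom_set S i j - P3 S i j a \<longrightarrow>
        green_class S i j (green_J (sandwich S i j a)) x
          = green_class S i j (green_D (sandwich S i j a)) x) \<and>

     (x \<in> hom_set S i j - P12 S i j a \<longrightarrow>
        green_class S i j (green_H (sandwich S i j a)) x = {x} \<and>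
        \<not> is_group_under (sandwich S i j a)
            (green_class S i j (green_H (sandwich S i j a)) x))"
proof -
  interpret sandwich_semigroup S i j a
    using assms(1,4) by (simp add: sandwich_semigroup_def sandwich_semigroup_axioms_def)
  note x = \<open>x \<in> hom_set S i j\<close>
  have P12_iff: "y \<in> P12 S i j a \<longleftrightarrow> (y, y) \<in> strict_R T \<and> (y, y) \<in> strict_L T" for y
    by (simp add: P12_def P1_iff P2_iff)
  note class_defs = green_class_def set_eq_iff Int_iff mem_Collect_eq insert_iff empty_iff
  have refl_R: "(x, x) \<in> green_R S" and refl_L: "(x, x) \<in> green_L S"
    using hom_set_simps(1)[OF x] by (simp_all add: green_R_refl green_L_refl)
  have R: "green_class S i j (green_R T) x = green_class S i j (green_R S) x \<inter> P1 S i j a"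
    if "x \<in> P1 S i j a"
    using that x refl_R
    unfolding class_defs P1_iff green_R_T_iff[OF x] by blast
  have R': "green_class S i j (green_R T) x = {x}" if "x \<notin> P1 S i j a"
    using that x
    unfolding class_defs P1_iff green_R_T_iff[OF x] by blast
  have L: "green_class S i j (green_L T) x = green_class S i j (green_L S) x \<inter> P2 S i j a"
    if "x \<in> P2 S i j a"
    using that x refl_L
    unfolding class_defs P2_iff green_L_T_iff[OF x] by blast
  have L': "green_class S i j (green_L T) x = {x}" if "x \<notin> P2 S i j a"
    using that x
    unfolding class_defs P2_iff green_L_T_iff[OF x] by blast
  have H: "green_class S i j (green_H T) x = green_class S i j (green_H S) x"
    if "x \<in> P12 S i j a"
    using that x green_H_T_regular[OF x]
    unfolding class_defs P12_iff by blast
  have H': "green_class S i j (green_H T) x = {x}" if "x \<notin> P12 S i j a"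
    using that x green_H_T_not_P12[OF x]
    unfolding class_defs P12_iff by metis
  have D: "green_class S i j (green_D T) x = green_class S i j (green_D S) x \<inter> P12 S i j a"
    if "x \<in> P12 S i j a"
    using that green_D_T_regular[OF x]
    unfolding class_defs P12_iff by blast
  \<comment> \<open>Assuming only \<open>x\<close> outside \<open>P1\<close> lets this combine with
    \<open>L'\<close> to settle elements outside both sets.\<close>
  have D1: "green_class S i j (green_D T) x = green_class S i j (green_L T) x"
    if "x \<notin> P1 S i j a"
    using that green_D_T_not_P1[OF x] by (simp add: green_class_def P1_iff)
  have D2: "green_class S i j (green_D T) x = green_class S i j (green_R T) x"
    if "x \<notin> P2 S i j a"
    using that green_D_T_not_P2[OF x] by (simp add: green_class_def P2_iff)
  have J: "green_class S i j (green_J T) x = green_class S i j (green_J S) x \<inter> P3 S i j a"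
    if "x \<in> P3 S i j a"
    using that green_J_T_regular[OF x]
    unfolding class_defs P3_iff by blast
  have J': "green_class S i j (green_J T) x = green_class S i j (green_D T) x"
    if "x \<notin> P3 S i j a"
    using that green_J_T_not_P3 by (simp add: green_class_def P3_iff)
  \<comment> \<open>By \<open>H'\<close> the \<open>H\<close>-class in question is
    \<open>{x}\<close>, so only this singleton has to be excluded as a group.\<close>
  have G: "\<not> is_group_under T {x}" if "x \<notin> P12 S i j a"
    using that singleton_group_imp_P12[OF x] P12_iff by blast
  show ?thesis
    using R R' L L' H H' D D1 D2 J J' G by auto
qed

end
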